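(* Every subgroup $\mathcal{G}$ of the semigroup $(\overline{\mathbb{R}}^{n\times n},\otimes)$ admits a faithful representation with tropical monomial $n$-by-$n$ matrices, i.e. there is an injective group homomorphism from $\mathcal{G}$ into the group of tropical monomial $n\times n$ matrices under $\otimes$.
   Context: The tropical semiring is $\overline{\mathbb{R}}=\mathbb{R}\cup\{-\infty\}$ with $a\oplus b=\max\{a,b\}$ and $a\otimes b=a+b$. Tropical matrix multiplication: $(X\otimes Y)_{ij}=\max_k (x_{ik}+y_{kj})$. A subgroup of the semigroup $(\overline{\mathbb{R}}^{n\times n},\otimes)$ is a subset that is a group under $\otimes$ (its identity need not be the tropical identity matrix, which has $0$ on the diagonal and $-\infty$ elsewhere). A matrix $P\in\overline{\mathbb{R}}^{n\times n}$ is monomial if there exists a permutation $\sigma$ of $\{1,\ldots,n\}$ such that $p_{ij}\neq-\infty$ if and only if $i=\sigma(j)$; the monomial matrices form a group under $\otimes$. *)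

theory Defs
  imports "HOL-Analysis.Cartesian_Space" "HOL-Algebra.Group"
    "HOL-Combinatorics.Permutations"
begin

section \<open>The tropical semiring\<close>

datatype trop = MInf | Fin real

instantiation trop :: linorder
begin

fun less_eq_trop :: "trop \<Rightarrow> trop \<Rightarrow> bool" where
  "less_eq_trop MInf _ \<longleftrightarrow> True"
| "less_eq_trop (Fin _) MInf \<longleftrightarrow> False"
| "less_eq_trop (Fin a) (Fin b) \<longleftrightarrow> a \<le> b"

definition less_trop :: "trop \<Rightarrow> trop \<Rightarrow> bool" where
  "less_trop x y \<longleftrightarrow> x \<le> y \<and> \<not> y \<le> x"

instance
proof
  fix x y z :: trop
  show "x < y \<longleftrightarrow> x \<le> y \<and> \<not> y \<le> x" by (rule less_trop_def)
  show "x \<le> x" by (cases x) auto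
  show "x \<le> y \<Longrightarrow> y \<le> z \<Longrightarrow> x \<le> z" by (cases x; cases y; cases z) auto
  show "x \<le> y \<Longrightarrow> y \<le> x \<Longrightarrow> x = y" by (cases x; cases y) auto
  show "x \<le> y \<or> y \<le> x" by (cases x; cases y) auto
qed

end

text \<open>
  The class operations on \<^typ>\<open>trop\<close> are the tropical ones: \<open>+\<close> is the maximum, \<open>*\<close> is real
  addition extended by \<^term>\<open>MInf\<close> as absorbing element, \<open>0\<close> is minus infinity and \<open>1\<close> is the
  real number zero. Hence the matrix product \<open>**\<close> of the library, used at type \<^typ>\<open>trop\<close>,
  is the tropical matrix product (lemma \<open>trop_matrix_mult_nth\<close>), and \<open>mat 1\<close> is
  the tropical identity matrix.
\<close>

instantiation trop :: comm_semiring_1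
begin

definition zero_trop :: trop where "zero_trop = MInf"

definition one_trop :: trop where "one_trop = Fin 0"

definition plus_trop :: "trop \<Rightarrow> trop \<Rightarrow> trop" where "plus_trop x y = max x y"

fun times_trop :: "trop \<Rightarrow> trop \<Rightarrow> trop" where
  "times_trop (Fin a) (Fin b) = Fin (a + b)"
| "times_trop MInf _ = MInf"
| "times_trop _ MInf = MInf"

instance
proof
  fix x y z :: trop
  show "x + y + z = x + (y + z)" by (simp add: plus_trop_def max.assoc)
  show "x + y = y + x" by (simp add: plus_trop_def max.commute)
  show "0 + x = x" by (simp add: plus_trop_def zero_trop_def max_def)
  show "x * y * z = x * (y * z)" by (cases x; cases y; cases z) auto
  show "x * y = y * x" by (cases x; cases y) auto
  show "1 * x = x" by (cases x) (auto simp: one_trop_def)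
  show "0 * x = 0" by (simp add: zero_trop_def)
  show "x * 0 = 0" by (cases x) (auto simp: zero_trop_def)
  show "(x + y) * z = x * z + y * z"
    by (cases x; cases y; cases z) (auto simp: plus_trop_def max_def)
  show "(0::trop) \<noteq> 1" by (simp add: zero_trop_def one_trop_def)
qed

end

section \<open>Tropical matrices\<close>

lemma trop_sum_eq_Max:
  fixes f :: "'a \<Rightarrow> trop"
  assumes "finite A" "A \<noteq> {}"
  shows "sum f A = Max (f ` A)"
proof -
  have "max x 0 = x" for x :: trop
    using add_0_right[of x] by (simp only: plus_trop_def)
  with assms show ?thesis
    by (induction A rule: finite_ne_induct) (simp_all add: plus_trop_def)
qed

lemma trop_matrix_mult_nth:
  fixes X :: "trop ^ 'n ^ 'm" and Y :: "trop ^ 'p ^ 'n"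
  shows "(X ** Y) $ i $ j = Max (range (\<lambda>k. X $ i $ k * Y $ k $ j))"
  by (simp add: matrix_matrix_mult_def trop_sum_eq_Max)

text \<open>
  A subgroup of the semigroup of tropical matrices is a set \<open>S\<close> for which the following structure
  is a group for some \<open>E\<close>, not necessarily \<open>mat 1\<close>.
\<close>

definition trop_mat_struct :: "(trop ^ 'n ^ 'n) set \<Rightarrow> trop ^ 'n ^ 'n \<Rightarrow> (trop ^ 'n ^ 'n) monoid"
  where "trop_mat_struct S E = \<lparr>carrier = S, monoid.mult = (**), one = E\<rparr>"

definition trop_monomial :: "trop ^ 'n ^ 'n \<Rightarrow> bool"
  where "trop_monomial P \<longleftrightarrow>
    (\<exists>\<sigma>. \<sigma> permutes UNIV \<and> (\<forall>i j. P $ i $ j \<noteq> MInf \<longleftrightarrow> i = \<sigma> j))"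

definition trop_monomial_group :: "(trop ^ 'n ^ 'n) monoid"
  where "trop_monomial_group = trop_mat_struct {P. trop_monomial P} (mat 1)"

lemma trop_sum_neq_MInf_iff:
  fixes f :: "'a \<Rightarrow> trop"
  assumes "finite A"
  shows "sum f A \<noteq> MInf \<longleftrightarrow> (\<exists>x\<in>A. f x \<noteq> MInf)"
proof -
  have "x + y = MInf \<longleftrightarrow> x = MInf \<and> y = MInf" for x y :: trop
    by (cases x; cases y) (auto simp: plus_trop_def max_def)
  with assms show ?thesis
    by (induction A rule: finite_induct) (auto simp: zero_trop_def)
qed

lemma trop_times_neq_MInf_iff: "x * y \<noteq> MInf \<longleftrightarrow> x \<noteq> MInf \<and> y \<noteq> MInf" for x y :: trop
  by (cases x; cases y) auto

lemma group_trop_monomial_group: "group (trop_monomial_group :: (trop ^ 'n ^ 'n) monoid)"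
proof (rule groupI)
  fix P Q :: "trop ^ 'n ^ 'n"
  assume "P \<in> carrier trop_monomial_group" "Q \<in> carrier trop_monomial_group"
  then obtain \<sigma> \<tau> where
    \<sigma>: "\<sigma> permutes UNIV" "\<And>i j. P $ i $ j \<noteq> MInf \<longleftrightarrow> i = \<sigma> j" and
    \<tau>: "\<tau> permutes UNIV" "\<And>i j. Q $ i $ j \<noteq> MInf \<longleftrightarrow> i = \<tau> j"
    unfolding trop_monomial_group_def trop_mat_struct_def trop_monomial_def by auto
  have "(P ** Q) $ i $ j \<noteq> MInf \<longleftrightarrow> i = (\<sigma> \<circ> \<tau>) j" for i j
    by (simp add: matrix_matrix_mult_def trop_sum_neq_MInf_iff trop_times_neq_MInf_iff \<sigma>(2) \<tau>(2)
        del: not_not)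
  moreover have "\<sigma> \<circ> \<tau> permutes UNIV"
    by (rule permutes_compose[OF \<tau>(1) \<sigma>(1)])
  ultimately show "P \<otimes>\<^bsub>trop_monomial_group\<^esub> Q \<in> carrier trop_monomial_group"
    unfolding trop_monomial_group_def trop_mat_struct_def trop_monomial_def by auto
next
  have "id permutes (UNIV :: 'n set) \<and> (\<forall>i j. (mat 1 :: trop ^ 'n ^ 'n) $ i $ j \<noteq> MInf \<longleftrightarrow> i = id j)"
    by (auto simp: mat_def zero_trop_def one_trop_def permutes_id)
  then show "\<one>\<^bsub>trop_monomial_group\<^esub> \<in> carrier (trop_monomial_group :: (trop ^ 'n ^ 'n) monoid)"
    unfolding trop_monomial_group_def trop_mat_struct_def trop_monomial_def by (auto intro!: exI[of _ id] simp: permutes_id)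
next
  fix P :: "trop ^ 'n ^ 'n"
  assume "P \<in> carrier trop_monomial_group"
  then obtain \<sigma> where \<sigma>: "\<sigma> permutes UNIV" "\<And>i j. P $ i $ j \<noteq> MInf \<longleftrightarrow> i = \<sigma> j"
    unfolding trop_monomial_group_def trop_mat_struct_def trop_monomial_def by auto
  have inj: "\<sigma> i = \<sigma> j \<longleftrightarrow> i = j" for i j
    using permutes_inj[OF \<sigma>(1)] by (auto dest: injD)
  have "\<exists>a. P $ (\<sigma> j) $ j = Fin a" for j
    using \<sigma>(2)[of "\<sigma> j" j] by (cases "P $ (\<sigma> j) $ j") auto
  then obtain a where a: "\<And>j. P $ (\<sigma> j) $ j = Fin (a j)" by metis
  define Q :: "trop ^ 'n ^ 'n" where "Q = (\<chi> j i. if i = \<sigma> j then Fin (- a j) else MInf)"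
  have "Q $ i $ k * P $ k $ j = (if k = \<sigma> i then (mat 1 :: trop ^ 'n ^ 'n) $ i $ j else 0)" for i j k
    using \<sigma>(2)[of k j] a[of j] inj[of i j]
    by (cases "i = j"; cases "P $ k $ j")
       (auto simp: Q_def mat_def zero_trop_def one_trop_def)
  then have "Q ** P = mat 1"
    by (simp add: vec_eq_iff matrix_matrix_mult_def)
  moreover have "trop_monomial Q"
    unfolding trop_monomial_def
  proof (intro exI conjI allI)
    show "inv_into UNIV \<sigma> permutes UNIV" by (rule permutes_inv[OF \<sigma>(1)])
    show "Q $ i $ j \<noteq> MInf \<longleftrightarrow> i = inv_into UNIV \<sigma> j" for i j
      using permutes_inv_eq[OF \<sigma>(1), of j i] by (auto simp: Q_def)
  qed
  ultimately show "\<exists>Q\<in>carrier trop_monomial_group.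
      Q \<otimes>\<^bsub>trop_monomial_group\<^esub> P = \<one>\<^bsub>trop_monomial_group\<^esub>"
    unfolding trop_monomial_group_def trop_mat_struct_def by auto
qed (simp_all add: trop_monomial_group_def trop_mat_struct_def matrix_mul_assoc)

end

(* The group acts on the column space of E by left multiplication. A smallest set of columns of E
   generating this space is unique up to scaling: its members are the extremal rays, which every
   group element permutes up to finite scalars. This permutation and these scalars form a
   monomial matrix, padded with an identity block, and they determine the group element A because
   A = A E. *)

theory Submission
  imports Defs
begin

section \<open>Tropical arithmetic\<close>

text \<open>Addition is the maximum, so the equation bounds each summand by \<open>x\<close>. In the
  absence of subtraction this plays the part of cancellation.\<close>

lemma trop_eq_add_left: "x = x + y + z \<Longrightarrow> x + y = x" for x y z :: trop
  by (cases x; cases y; cases z) (auto simp: plus_trop_def max_def split: if_splits)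

text \<open>For finite \<open>x\<close>, a scalar above \<open>1\<close> would push
  \<open>c * x\<close> beyond \<open>x\<close>, and one below \<open>1\<close> leaves it strictly
  smaller, so \<open>s\<close> must attain the maximum. For \<open>x = MInf\<close> the equation
  itself gives \<open>s = MInf\<close>.\<close>

lemma trop_scaled_summand_redundant:
  fixes x c s :: trop
  assumes "x = c * x + s" "c \<noteq> 1"
  shows "x = s"
  using assms
  by (cases x; cases c; cases s) (auto simp: plus_trop_def one_trop_def max_def split: if_splits)

lemma trop_sum_eq_1_obtains:
  fixes f :: "'a \<Rightarrow> trop"
  assumes "finite A" "sum f A = 1"
  obtains i where "i \<in> A" "f i = 1"
proof -
  have "A \<noteq> {}" using assms by auto
  then have "1 \<in> f ` A"
    using assms trop_sum_eq_Max[of A f] Max_in[of "f ` A"] by auto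
  with that show thesis by auto
qed

lemma trop_mult_eq_1_finite:
  fixes x y :: trop
  assumes "x * y = 1"
  obtains a where "x = Fin a"
  using assms by (cases x) (auto simp: one_trop_def)

section \<open>Minimal generating sets of columns\<close>

definition generating_columns :: "trop ^ 'n ^ 'm \<Rightarrow> 'n set \<Rightarrow> bool"
  where "generating_columns E I \<longleftrightarrow> (\<forall>j. \<exists>c. column j E = (\<Sum>i\<in>I. c i *s column i E))"

text \<open>Least cardinality makes existence immediate, and irredundancy follows because deleting a
  redundant index would leave a smaller generating set.\<close>

definition column_basis :: "trop ^ 'n ^ 'm \<Rightarrow> 'n set \<Rightarrow> bool"
  where "column_basis E I \<longleftrightarrow> generating_columns E I \<and>
    (\<forall>J. generating_columns E J \<longrightarrow> card I \<le> card J)"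

section \<open>Linearity over a commutative semiring\<close>

lemma vector_smult_sum_right: "c *s (\<Sum>i\<in>A. f i) = (\<Sum>i\<in>A. c *s f i)"
  for c :: "'a::comm_semiring_1" and f :: "'b \<Rightarrow> 'a ^ 'n"
  by (simp add: vec_eq_iff sum_distrib_left)

lemma vector_smult_sum_left: "(\<Sum>i\<in>A. c i) *s x = (\<Sum>i\<in>A. c i *s x)"
  for c :: "'b \<Rightarrow> 'a::comm_semiring_1" and x :: "'a ^ 'n"
  by (simp add: vec_eq_iff sum_distrib_right)

lemma mult_vec_scaled: "A *v (c *s x) = c *s (A *v x)"
  for A :: "'a::comm_semiring_1 ^ 'n ^ 'm"
  by (simp add: vec_eq_iff matrix_vector_mult_def sum_distrib_left mult.left_commute)

lemma mult_vec_sum_scaled: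
  fixes A :: "'a::comm_semiring_1 ^ 'n ^ 'm"
  shows "A *v (\<Sum>i\<in>S. c i *s f i) = (\<Sum>i\<in>S. c i *s (A *v f i))"
proof -
  have "A *v 0 = 0" by (simp add: vec_eq_iff matrix_vector_mult_def)
  then show ?thesis
    by (induction S rule: infinite_finite_induct)
      (simp_all add: matrix_vector_right_distrib mult_vec_scaled)
qed

lemma sum_indicator_scaled:
  fixes v :: "'b \<Rightarrow> 'a::comm_semiring_1 ^ 'n"
  assumes "finite S" "k \<in> S"
  shows "(\<Sum>i\<in>S. (if i = k then c else 0) *s v i) = c *s v k"
proof -
  have "(\<Sum>i\<in>S. (if i = k then c else 0) *s v i) = (\<Sum>i\<in>S. if i = k then c *s v k else 0)"
    by (rule sum.cong) auto
  with assms show ?thesis by simp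
qed

lemma column_basis_exists: "\<exists>I. column_basis (E :: trop ^ 'n ^ 'm) I"
proof -
  have "column j E = (\<Sum>i\<in>UNIV. (if i = j then 1 else 0) *s column i E)" for j
    by (subst sum_indicator_scaled) auto
  then have "generating_columns E UNIV"
    unfolding generating_columns_def by (intro allI exI)
  from ex_has_least_nat[of "generating_columns E" UNIV card, OF this] show ?thesis
    unfolding column_basis_def by blast
qed

text \<open>Substituting such a relation into the expansion of every column would make
  \<open>I - {i}\<close> generating.\<close>

lemma column_basis_independent:
  fixes E :: "trop ^ 'n ^ 'm"
  assumes basis: "column_basis E I" and i: "i \<in> I"
  shows "column i E \<noteq> (\<Sum>k\<in>I-{i}. c k *s column k E)"
proof
  assume eq: "column i E = (\<Sum>k\<in>I-{i}. c k *s column k E)"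
  have "\<exists>d. column j E = (\<Sum>k\<in>I-{i}. d k *s column k E)" for j
  proof -
    obtain d where "column j E = (\<Sum>k\<in>I. d k *s column k E)"
      using basis unfolding column_basis_def generating_columns_def by blast
    also have "\<dots> = d i *s column i E + (\<Sum>k\<in>I-{i}. d k *s column k E)"
      using i by (simp add: sum.remove)
    also have "\<dots> = (\<Sum>k\<in>I-{i}. (d i * c k) *s column k E) + (\<Sum>k\<in>I-{i}. d k *s column k E)"
      by (simp add: eq vector_smult_sum_right vector_smult_assoc)
    also have "\<dots> = (\<Sum>k\<in>I-{i}. (d i * c k + d k) *s column k E)"
      by (simp add: vector_sadd_rdistrib sum.distrib)
    finally show ?thesis by (intro exI)
  qed
  then have "generating_columns E (I - {i})"
    unfolding generating_columns_def by blast
  with basis have "card I \<le> card (I - {i})"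
    unfolding column_basis_def by blast
  moreover have "card (I - {i}) < card I"
    by (rule card_Diff1_less) (use i in auto)
  ultimately show False by simp
qed

text \<open>Expansions in a basis need not be unique tropically, but a basis column's coefficient at
  itself is forced: otherwise its own term could be dropped in every entry, contradicting
  independence.\<close>

lemma column_basis_coeff_self:
  fixes E :: "trop ^ 'n ^ 'm"
  assumes basis: "column_basis E I" and j: "j \<in> I"
    and eq: "column j E = (\<Sum>i\<in>I. c i *s column i E)"
  shows "c j = 1"
proof (rule ccontr)
  assume ne: "c j \<noteq> 1"
  define s where "s = (\<Sum>i\<in>I-{j}. c i *s column i E)"
  have "column j E = c j *s column j E + s"
    using eq j unfolding s_def by (simp add: sum.remove)
  then have "column j E $ l = c j * column j E $ l + s $ l" for l
    by (metis vector_add_component vector_smult_component)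
  then have "column j E = s"
    using trop_scaled_summand_redundant[OF _ ne] by (simp add: vec_eq_iff)
  with column_basis_independent[OF basis j] show False
    unfolding s_def by blast
qed

text \<open>Distinct basis columns are not proportional, which will make the permutation and the
  scalars of a group element well defined.\<close>

lemma column_basis_scaled_unique:
  fixes E :: "trop ^ 'n ^ 'm"
  assumes basis: "column_basis E I" and "i \<in> I" "k \<in> I"
    and eq: "Fin c *s column i E = Fin d *s column k E"
  shows "i = k \<and> c = d"
proof -
  have "column i E = Fin (- c) *s (Fin c *s column i E)"
    by (simp add: vector_smult_assoc flip: one_trop_def)
  also have "\<dots> = Fin (d - c) *s column k E"
    by (simp add: eq vector_smult_assoc)
  \<comment> \<open>An expansion with at most one finite coefficient; its coefficient at
    \<open>i\<close> has to be \<open>1\<close>.\<close>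
  also have "\<dots> = (\<Sum>m\<in>I. (if m = k then Fin (d - c) else 0) *s column m E)"
    using \<open>k \<in> I\<close> by (subst sum_indicator_scaled) auto
  finally have "(if i = k then Fin (d - c) else 0) = 1"
    by (rule column_basis_coeff_self[OF basis \<open>i \<in> I\<close>])
  then show ?thesis by (auto simp: one_trop_def zero_trop_def split: if_splits)
qed

section \<open>The action on the column space\<close>

lemma generating_columns_mult_vec:
  fixes E :: "trop ^ 'n ^ 'm"
  assumes "generating_columns E I"
  shows "\<exists>d. E *v x = (\<Sum>i\<in>I. d i *s column i E)"
proof -
  obtain c where c: "\<And>j. column j E = (\<Sum>i\<in>I. c j i *s column i E)"
    using assms unfolding generating_columns_def by metis
  have "E *v x = (\<Sum>j\<in>UNIV. x $ j *s column j E)"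
    by (rule matrix_mult_sum)
  also have "\<dots> = (\<Sum>j\<in>UNIV. \<Sum>i\<in>I. (x $ j * c j i) *s column i E)"
    by (subst c) (simp add: vector_smult_sum_right vector_smult_assoc)
  also have "\<dots> = (\<Sum>i\<in>I. (\<Sum>j\<in>UNIV. x $ j * c j i) *s column i E)"
    by (subst sum.swap) (simp add: vector_smult_sum_left)
  finally show ?thesis by (intro exI)
qed

lemma mult_vec_column: "A *v column j B = column j (A ** B)"
  by (simp add: vec_eq_iff column_def matrix_vector_mult_def matrix_matrix_mult_def)

lemma column_basis_mult_eqI:
  fixes E :: "trop ^ 'n ^ 'm"
  assumes "column_basis E I" and eq: "\<And>i. i \<in> I \<Longrightarrow> A *v column i E = B *v column i E"
  shows "A ** E = B ** E"
proof -
  have "A *v column j E = B *v column j E" for j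
  proof -
    obtain c where c: "column j E = (\<Sum>i\<in>I. c i *s column i E)"
      using assms(1) unfolding column_basis_def generating_columns_def by blast
    have "(\<Sum>i\<in>I. c i *s (A *v column i E)) = (\<Sum>i\<in>I. c i *s (B *v column i E))"
      by (simp add: eq)
    then show ?thesis unfolding c mult_vec_sum_scaled .
  qed
  then have "column j (A ** E) = column j (B ** E)" for j
    by (simp add: mult_vec_column)
  then show ?thesis by (simp add: vec_eq_iff column_def)
qed

text \<open>Basis columns are extremal. Expanding \<open>A' *v (A *v ?v j) = ?v j\<close> singles
  out one term that already reproduces \<open>?v j\<close>; all other terms are dominated by it and
  disappear, and applying \<open>A\<close> turns this into the claim.\<close>

lemma invertible_action_on_column_basis:
  fixes E A A' :: "trop ^ 'n ^ 'n"
  assumes basis: "column_basis E I" and j: "j \<in> I"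
    and id: "E ** E = E" "E ** A = A" "A ** E = A" "E ** A' = A'" "A' ** E = A'"
    and inv: "A ** A' = E" "A' ** A = E"
  shows "\<exists>i\<in>I. \<exists>a. A *v column j E = Fin a *s column i E"
proof -
  let ?v = "\<lambda>i. column i E"
  have gen: "generating_columns E I"
    using basis unfolding column_basis_def by simp
  \<comment> \<open>\<open>B ** E = B\<close> turns \<open>B *v ?v k\<close> into column
    \<open>k\<close> of \<open>B\<close>, and \<open>E ** B = B\<close> places that column in the
    column space of \<open>E\<close>.\<close>
  have act: "\<exists>d. B *v ?v k = (\<Sum>i\<in>I. d i *s ?v i)" if "E ** B = B" "B ** E = B" for B k
    using generating_columns_mult_vec[OF gen, of "column k B"] that
    by (simp add: mult_vec_column)
  obtain b where b: "A *v ?v j = (\<Sum>i\<in>I. b i *s ?v i)"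
    using act id by blast
  obtain b' where b': "\<And>k. A' *v ?v k = (\<Sum>i\<in>I. b' k i *s ?v i)"
    using act[of A'] id by metis
  have A'Av: "A' *v (A *v ?v j) = ?v j"
    by (simp add: mult_vec_column matrix_mul_assoc inv id)
  have "?v j = (\<Sum>i\<in>I. b i *s (\<Sum>k\<in>I. b' i k *s ?v k))"
    using A'Av by (simp add: b mult_vec_sum_scaled b')
  also have "\<dots> = (\<Sum>i\<in>I. \<Sum>k\<in>I. (b i * b' i k) *s ?v k)"
    by (simp add: vector_smult_sum_right vector_smult_assoc)
  also have "\<dots> = (\<Sum>k\<in>I. (\<Sum>i\<in>I. b i * b' i k) *s ?v k)"
    by (subst sum.swap) (simp add: vector_smult_sum_left)
  finally have "(\<Sum>i\<in>I. b i * b' i j) = 1"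
    by (rule column_basis_coeff_self[OF basis j])
  \<comment> \<open>A tropical sum is attained by one of its terms; this \<open>i\<close> will be
    the image of \<open>j\<close>.\<close>
  then obtain i where i: "i \<in> I" "b i * b' i j = 1"
    by (rule trop_sum_eq_1_obtains[rotated]) auto
  define r where "r = (\<Sum>k\<in>I-{i}. b k *s ?v k)"
  define r' where "r' = (\<Sum>k\<in>I-{j}. b' i k *s ?v k)"
  have Av: "A *v ?v j = b i *s ?v i + r"
    using i by (simp add: b r_def sum.remove)
  have "A' *v ?v i = b' i j *s ?v j + r'"
    using j by (simp add: b' r'_def sum.remove)
  then have A'v: "b i *s (A' *v ?v i) = ?v j + b i *s r'"
    using i by (simp add: vector_add_ldistrib vector_smult_assoc)
  \<comment> \<open>By \<open>A'v\<close>, the vector \<open>b i *s (A' *v ?v i)\<close> is at least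
    \<open>?v j\<close>; this equation also bounds it above by \<open>?v j\<close>, so the two are
    equal.\<close>
  have "?v j = ?v j + b i *s r' + A' *v r"
    using A'Av by (simp add: Av matrix_vector_right_distrib mult_vec_scaled A'v)
  then have "?v j $ l = ?v j $ l + (b i *s r') $ l + (A' *v r) $ l" for l
    by (metis vector_add_component)
  then have "?v j + b i *s r' = ?v j"
    unfolding vec_eq_iff vector_add_component by (intro allI trop_eq_add_left)
  then have "A *v ?v j = A *v (b i *s (A' *v ?v i))"
    by (simp add: A'v)
  also have "\<dots> = b i *s ?v i"
    by (simp add: mult_vec_scaled mult_vec_column matrix_mul_assoc inv id)
  finally have "A *v ?v j = b i *s ?v i" .
  moreover obtain a where "b i = Fin a"
    using trop_mult_eq_1_finite[OF i(2)] .
  ultimately show ?thesis using i(1) by auto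
qed

section \<open>Monomial matrices\<close>

definition monomial_mat :: "('n \<Rightarrow> 'n) \<Rightarrow> ('n \<Rightarrow> real) \<Rightarrow> trop ^ 'n ^ 'n"
  where "monomial_mat \<sigma> a = (\<chi> i j. if i = \<sigma> j then Fin (a j) else 0)"

text \<open>Column \<open>j\<close> of the right factor is finite only in row
  \<open>\<tau> j\<close>, so each sum collapses to one term.\<close>

lemma monomial_mat_mult:
  "monomial_mat \<sigma> a ** monomial_mat \<tau> b = monomial_mat (\<sigma> \<circ> \<tau>) (\<lambda>j. a (\<tau> j) + b j)"
proof -
  have "monomial_mat \<sigma> a $ i $ k * monomial_mat \<tau> b $ k $ j
      = (if k = \<tau> j then monomial_mat (\<sigma> \<circ> \<tau>) (\<lambda>j. a (\<tau> j) + b j) $ i $ j else 0)" for i j k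
    by (simp add: monomial_mat_def)
  then show ?thesis by (simp add: vec_eq_iff matrix_matrix_mult_def)
qed

lemma monomial_mat_eq_iff: "monomial_mat \<sigma> a = monomial_mat \<tau> b \<longleftrightarrow> \<sigma> = \<tau> \<and> a = b"
proof
  assume eq: "monomial_mat \<sigma> a = monomial_mat \<tau> b"
  have "\<sigma> j = \<tau> j \<and> a j = b j" for j
  proof -
    have "monomial_mat \<sigma> a $ \<sigma> j $ j = monomial_mat \<tau> b $ \<sigma> j $ j" by (simp add: eq)
    then show ?thesis by (auto simp: monomial_mat_def zero_trop_def split: if_splits)
  qed
  then show "\<sigma> = \<tau> \<and> a = b" by auto
qed simp

lemma trop_monomial_monomial_mat:
  fixes \<sigma> :: "'n::finite \<Rightarrow> 'n"
  assumes "inj \<sigma>"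
  shows "trop_monomial (monomial_mat \<sigma> a)"
proof -
  have "\<sigma> permutes UNIV"
    using assms by (intro bij_imp_permutes) (auto simp: bij_def finite_UNIV_inj_surj)
  then show ?thesis
    unfolding trop_monomial_def
    by (intro exI[of _ \<sigma>]) (auto simp: monomial_mat_def zero_trop_def)
qed

section \<open>The representation\<close>

theorem theorem2p4:
  fixes G :: "(trop ^ 'n ^ 'n) set" and E :: "trop ^ 'n ^ 'n"
  assumes "group (trop_mat_struct G E)"
  shows "\<exists>\<phi> \<in> hom (trop_mat_struct G E) (trop_monomial_group :: (trop ^ 'n ^ 'n) monoid).
    inj_on \<phi> G"
proof -
  interpret G: group "trop_mat_struct G E" by fact
  have carrier: "carrier (trop_mat_struct G E) = G"
    and mult: "\<And>A B. A \<otimes>\<^bsub>trop_mat_struct G E\<^esub> B = A ** B"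
    and one: "\<one>\<^bsub>trop_mat_struct G E\<^esub> = E"
    by (simp_all add: trop_mat_struct_def)
  note struct = carrier mult one
  have EG: "E \<in> G" and closed: "\<And>A B. A \<in> G \<Longrightarrow> B \<in> G \<Longrightarrow> A ** B \<in> G"
    and EA: "\<And>A. A \<in> G \<Longrightarrow> E ** A = A" and AE: "\<And>A. A \<in> G \<Longrightarrow> A ** E = A"
    using G.one_closed G.m_closed G.l_one G.r_one by (simp_all add: struct)
  have inv: "\<exists>A'\<in>G. A ** A' = E \<and> A' ** A = E" if "A \<in> G" for A
    using that G.inv_closed[of A] G.r_inv[of A] G.l_inv[of A] by (auto simp: struct)
  obtain I where basis: "column_basis E I"
    using column_basis_exists by blast
  let ?v = "\<lambda>i. column i E"
  \<comment> \<open>Indices outside the basis are fixed with real scalar \<open>0\<close>, the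
    tropical unit; this is the identity block that pads the matrix to full size.\<close>
  have "\<exists>i a. if j \<in> I then i \<in> I \<and> A *v ?v j = Fin a *s ?v i else i = j \<and> a = 0"
    if A: "A \<in> G" for A j
  proof -
    obtain A' where "A' \<in> G" "A ** A' = E" "A' ** A = E"
      using inv[OF A] by blast
    then have "j \<in> I \<Longrightarrow> \<exists>i\<in>I. \<exists>a. A *v ?v j = Fin a *s ?v i"
      using invertible_action_on_column_basis[OF basis, of j A A'] EA AE EG A by blast
    then show ?thesis by auto
  qed
  then obtain \<sigma> a where \<sigma>a: "\<And>A j. A \<in> G \<Longrightarrow>
      if j \<in> I then \<sigma> A j \<in> I \<and> A *v ?v j = Fin (a A j) *s ?v (\<sigma> A j)
      else \<sigma> A j = j \<and> a A j = 0"
    by metis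
  \<comment> \<open>The values of \<open>\<sigma>\<close> and \<open>a\<close> were merely chosen.
    Since their specification has only one solution, multiplicativity reduces to checking that the
    composed data satisfy it for \<open>A ** B\<close>.\<close>
  have char: "\<sigma> A j = i \<and> a A j = c"
    if "A \<in> G" "if j \<in> I then i \<in> I \<and> A *v ?v j = Fin c *s ?v i else i = j \<and> c = 0" for A i j c
  proof (cases "j \<in> I")
    case True
    then have "\<sigma> A j \<in> I" "i \<in> I" "Fin (a A j) *s ?v (\<sigma> A j) = Fin c *s ?v i"
      using that \<sigma>a[OF \<open>A \<in> G\<close>, of j] by simp_all
    then show ?thesis by (rule column_basis_scaled_unique[OF basis])
  next
    case False
    then show ?thesis using that \<sigma>a[OF \<open>A \<in> G\<close>, of j] by simp
  qed
  have \<sigma>_mult: "\<sigma> (A ** B) j = \<sigma> A (\<sigma> B j) \<and> a (A ** B) j = a A (\<sigma> B j) + a B j"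
    if A: "A \<in> G" and B: "B \<in> G" for A B j
  proof (rule char[OF closed[OF A B]])
    show "if j \<in> I
      then \<sigma> A (\<sigma> B j) \<in> I \<and>
        (A ** B) *v ?v j = Fin (a A (\<sigma> B j) + a B j) *s ?v (\<sigma> A (\<sigma> B j))
      else \<sigma> A (\<sigma> B j) = j \<and> a A (\<sigma> B j) + a B j = 0"
      using \<sigma>a[OF B, of j] \<sigma>a[OF A, of "\<sigma> B j"]
      by (auto simp: mult_vec_scaled vector_smult_assoc add.commute
          simp flip: matrix_vector_mul_assoc split: if_splits)
  qed
  have \<sigma>_E: "\<sigma> E j = j" for j
    using char[OF EG, of j j 0] EA[OF EG]
    by (simp add: mult_vec_column flip: one_trop_def)
  define \<phi> where "\<phi> A = monomial_mat (\<sigma> A) (a A)" for A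
  have monomial: "trop_monomial (\<phi> A)" if A: "A \<in> G" for A
  proof -
    obtain A' where A': "A' \<in> G" "A' ** A = E"
      using inv[OF A] by blast
    \<comment> \<open>The group inverse supplies a left inverse of \<open>\<sigma> A\<close>; on the
      finite index type injectivity already yields a permutation.\<close>
    then have "\<sigma> A' (\<sigma> A j) = j" for j
      using \<sigma>_mult[OF A'(1) A, of j] \<sigma>_E by simp
    then have "inj (\<sigma> A)" by (rule inj_on_inverseI)
    then show ?thesis unfolding \<phi>_def by (rule trop_monomial_monomial_mat)
  qed
  have "\<phi> (A ** B) = \<phi> A ** \<phi> B" if "A \<in> G" "B \<in> G" for A B
    unfolding \<phi>_def monomial_mat_mult monomial_mat_eq_iff using \<sigma>_mult[OF that] by auto
  with monomial have "\<phi> \<in> hom (trop_mat_struct G E) trop_monomial_group"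
    by (auto simp: hom_def trop_monomial_group_def trop_mat_struct_def)
  moreover have "inj_on \<phi> G"
  proof (rule inj_onI)
    fix A B assume A: "A \<in> G" and B: "B \<in> G" and "\<phi> A = \<phi> B"
    then have "\<sigma> A = \<sigma> B" "a A = a B" by (auto simp: \<phi>_def monomial_mat_eq_iff)
    \<comment> \<open>Equal permutations and scalars give equal actions on the basis, hence on all
      columns of \<open>E\<close>; the right identity \<open>E\<close> then recovers
      \<open>A\<close> and \<open>B\<close>.\<close>
    then have "A *v ?v i = B *v ?v i" if "i \<in> I" for i
      using \<sigma>a[OF A, of i] \<sigma>a[OF B, of i] that by simp
    then have "A ** E = B ** E" by (rule column_basis_mult_eqI[OF basis])
    then show "A = B" using AE A B by simp
  qed
  ultimately show ?thesis by blast
qed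

end
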